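(* Let $\tilde{y}^{(k)}=(y_1^{(k)},\dots,y_{m+1}^{(k)})$, $k\ge0$, be the dual iterates generated by the extended Dykstra's algorithm described in the context. Define, for $(y_1,\dots,y_m)\in X^m$, $$h(y_1,\dots,y_m)=\tfrac12\|d-(y_1+\cdots+y_m)\|^2+\sum_{i=1}^m\delta^*(y_i,C_i),$$ and, for $k\ge0$ and $(y_1,\dots,y_{m+1})\in X^{m+1}$, $$h^k(y_1,\dots,y_{m+1})=\tfrac12\|d-(y_1+\cdots+y_{m+1})\|^2+\sum_{i=1}^m\delta^*(y_i,C_i)+\delta^*(y_{m+1},H_{m+1}^k).$$ Suppose that a minimizer $\tilde y^*=(y_1^*,\dots,y_m^* )$ of $h$ exists and that, with $y_{m+1}^*:=0$, the number $M_i=\sup\{\|y_i^{(k)}-y_i^*\|:k\ge0\}$ is finite for all $i\in\{1,\dots,m+1\}$. Then $h^k(y_1^{(k)},\dots,y_{m+1}^{(k)})$ converges to $h(\tilde y^* )$ at a rate of $O(1/k)$; that is, there is a constant $K$ such that $|h^k(\tilde y^{(k)})-h(\tilde y^* )|\le K/k$ for all $k\ge1$.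
   Context: Let $X$ be a real Hilbert space, $d\in X$, $m\ge 1$, $C_1,\dots,C_m\subset X$ closed convex sets, and assume $C:=\bigcap_{i=1}^m C_i\neq\emptyset$. For a nonempty closed convex set $D$, $P_D$ denotes the projection onto $D$, and $\delta^*(y,D)=\sup_{x\in D}\langle y,x\rangle\in(-\infty,+\infty]$ is the support function. Extended Dykstra's algorithm: choose arbitrary $y_1^{(0)},\dots,y_m^{(0)}\in X$, and set $y_{m+1}^{(0)}=0$, $H_{m+1}^0=X$, $x_{m+1}^{(0)}=d-\sum_{i=1}^{m+1}y_i^{(0)}$. For $k=1,2,\dots$: - Set $x_0^{(k)}=x_{m+1}^{(k-1)}$. - For $i=1,\dots,m$ in order: $z_i^{(k)}=x_{i-1}^{(k)}+y_i^{(k-1)}$, $x_i^{(k)}=P_{C_i}(z_i^{(k)})$, $y_i^{(k)}=z_i^{(k)}-x_i^{(k)}$. - Choose any closed convex set $C_{m+1}^k\subset X$ with $C\subset C_{m+1}^k\subset H_{m+1}^{k-1}$. - Set $z_{m+1}^{(k)}=x_m^{(k)}+y_{m+1}^{(k-1)}$, $x_{m+1}^{(k)}=P_{C_{m+1}^k}(z_{m+1}^{(k)})$, $y_{m+1}^{(k)}=z_{m+1}^{(k)}-x_{m+1}^{(k)}$. - Set $H_{m+1}^k=\{x\in X:\langle y_{m+1}^{(k)},x-x_{m+1}^{(k)}\rangle\le 0\}$. *)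

theory Defs
  imports "HOL-Analysis.Analysis"
begin

text \<open>A real Hilbert space is a type of class \<open>{real_inner, complete_space}\<close>.
  The library's \<open>closest_point\<close> needs \<open>heine_borel\<close>, which forces finite dimension, so the
  projection is defined here. The minimizer exists and is unique for nonempty closed convex \<open>D\<close>,
  the only case in which \<open>proj\<close> is meaningful.\<close>

definition proj :: "'a::{real_inner,complete_space} set \<Rightarrow> 'a \<Rightarrow> 'a" where
  "proj D z = (THE p. p \<in> D \<and> (\<forall>x\<in>D. dist z p \<le> dist z x))"

definition support_function :: "'a::real_inner \<Rightarrow> 'a set \<Rightarrow> ereal" where
  "support_function y D = (SUP x\<in>D. ereal (inner y x))"

text \<open>Tuples in \<open>X\<^sup>n\<close> are functions \<open>nat \<Rightarrow> 'a\<close> of which only the values at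
  \<open>1, \<dots>, n\<close> are used. Iterates carry the iteration number first:
  \<open>y k i\<close> is $y_i^{(k)}$. \<open>D k\<close> and \<open>H k\<close> are $C_{m+1}^k$ and $H_{m+1}^k$.
  Entries not assigned by the algorithm (\<open>z 0 i\<close>, \<open>x 0 i\<close> for \<open>i \<le> m\<close>, \<open>D 0\<close>) are unconstrained,
  and so are the arbitrary starting points \<open>y 0 i\<close> for \<open>1 \<le> i \<le> m\<close>.\<close>

definition extended_dykstra ::
    "'a::{real_inner,complete_space} \<Rightarrow> nat \<Rightarrow> (nat \<Rightarrow> 'a set) \<Rightarrow> (nat \<Rightarrow> 'a set) \<Rightarrow> (nat \<Rightarrow> 'a set)
      \<Rightarrow> (nat \<Rightarrow> nat \<Rightarrow> 'a) \<Rightarrow> (nat \<Rightarrow> nat \<Rightarrow> 'a) \<Rightarrow> (nat \<Rightarrow> nat \<Rightarrow> 'a) \<Rightarrow> bool" where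
  "extended_dykstra d m C D H x y z \<longleftrightarrow>
     y 0 (m+1) = 0 \<and>
     H 0 = UNIV \<and>
     x 0 (m+1) = d - (\<Sum>i=1..m+1. y 0 i) \<and>
     (\<forall>k\<ge>1.
        x k 0 = x (k-1) (m+1) \<and>
        (\<forall>i\<in>{1..m}.
           z k i = x k (i-1) + y (k-1) i \<and>
           x k i = proj (C i) (z k i) \<and>
           y k i = z k i - x k i) \<and>
        closed (D k) \<and> convex (D k) \<and>
        (\<Inter>i\<in>{1..m}. C i) \<subseteq> D k \<and> D k \<subseteq> H (k-1) \<and>
        z k (m+1) = x k m + y (k-1) (m+1) \<and>
        x k (m+1) = proj (D k) (z k (m+1)) \<and>
        y k (m+1) = z k (m+1) - x k (m+1) \<and>
        H k = {u. inner (y k (m+1)) (u - x k (m+1)) \<le> 0})"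

definition dual_h :: "'a::real_inner \<Rightarrow> nat \<Rightarrow> (nat \<Rightarrow> 'a set) \<Rightarrow> (nat \<Rightarrow> 'a) \<Rightarrow> ereal" where
  "dual_h d m C v =
     ereal (1/2 * (norm (d - (\<Sum>i=1..m. v i)))\<^sup>2) + (\<Sum>i=1..m. support_function (v i) (C i))"

text \<open>The function $h^k$ is \<open>dual_hk d m C (H k)\<close>.\<close>

definition dual_hk ::
    "'a::real_inner \<Rightarrow> nat \<Rightarrow> (nat \<Rightarrow> 'a set) \<Rightarrow> 'a set \<Rightarrow> (nat \<Rightarrow> 'a) \<Rightarrow> ereal" where
  "dual_hk d m C Hk v =
     ereal (1/2 * (norm (d - (\<Sum>i=1..m+1. v i)))\<^sup>2)
       + (\<Sum>i=1..m. support_function (v i) (C i)) + support_function (v (m+1)) Hk"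

end

theory Submission
  imports Defs
begin

text \<open>
  The extended algorithm is block coordinate descent on the dual function, and the rate is that of
  a descent method whose suboptimality is bounded by the length of its last step. Write \<open>n = m + 1\<close>,
  let \<open>\<Delta>\<^sub>i\<close> be the change of the \<open>i\<close>-th dual block during sweep \<open>k\<close>, and let \<open>e\<^sub>k\<close> be the excess of
  $h^k(\tilde y^{(k)})$ over the minimum of \<open>h\<close>. A projection residual \<open>z - P z\<close> is a normal vector at
  \<open>P z\<close>, so for \<open>k \<ge> 1\<close> every support function in $h^k(\tilde y^{(k)})$ is finite and equals
  $\langle y_i^{(k)}, x_i^{(k)}\rangle$. At the arbitrary starting point the values may be
  infinite, so sweeps are compared from \<open>k = 2\<close> on. Three estimates are then combined.

  \<^item> Descent: \<open>\<Sum>\<^sub>i \<parallel>\<Delta>\<^sub>i\<parallel>\<^sup>2 \<le> 2 (e\<^sub>k\<^sub>-\<^sub>1 - e\<^sub>k)\<close> for \<open>k \<ge> 2\<close>. Each block update is a proximal step, which gains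
    half the squared step length (\<open>block_descent\<close>, \<open>sweep_descent\<close>). For the last block the function
    itself changes between sweeps, and $C_{m+1}^k \subset H_{m+1}^{k-1}$ ensures that the change
    only helps.
  \<^item> Gap: \<open>e\<^sub>k \<le> (\<Sum>\<^sub>i M\<^sub>i) (\<Sum>\<^sub>i \<parallel>\<Delta>\<^sub>i\<parallel>)\<close>. The vector $x_i^{(k)}$ is a subgradient of the \<open>i\<close>-th support
    function at $y_i^{(k)}$, and it differs from the final residual $x_n^{(k)}$ of the sweep by the
    steps made after block \<open>i\<close> (\<open>sweep_partial\<close>, \<open>sweep_gap\<close>).
  \<^item> Sign: \<open>e\<^sub>k \<ge> 0\<close>. At a dual minimizer the point \<open>q = d - \<Sum>\<^sub>i y\<^sub>i\<^sup>*\<close> lies in every \<open>C\<^sub>i\<close> and attains the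
    support function of \<open>C\<^sub>i\<close> at \<open>y\<^sub>i\<^sup>*\<close> (\<open>dual_minimizer_optimality\<close>). As \<open>q\<close> also lies in $H_{m+1}^k$,
    testing all support functions with \<open>q\<close> leaves \<open>e\<^sub>k \<ge> \<parallel>x\<^sub>n - q\<parallel>\<^sup>2 / 2\<close>, where \<open>x\<^sub>n\<close> stands for
    $x_n^{(k)}$.

  By the Cauchy-Schwarz inequality, descent and gap give \<open>e\<^sub>k\<^sup>2 \<le> A (e\<^sub>k\<^sub>-\<^sub>1 - e\<^sub>k)\<close> with a constant \<open>A\<close>, and a
  nonnegative sequence with this property is \<open>O(1/k)\<close> (\<open>quadratic_recursion_rate\<close>).
\<close>

section \<open>Projections and support functions in Hilbert space\<close>

text \<open>The parallelogram identity: two nearly closest points of a convex set are near each other,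
  since their midpoint is no closer than the distance to the set. In the absence of compactness,
  this is what makes minimizing sequences converge.\<close>

lemma infdist_midpoint_bound:
  fixes z :: "'a::real_inner"
  assumes "convex D" "a \<in> D" "b \<in> D" "dist z a \<le> infdist z D + e" "dist z b \<le> infdist z D + e"
  shows "(dist a b)\<^sup>2 \<le> 4 * e * (2 * infdist z D + e)"
proof -
  let ?r = "infdist z D"
  let ?m = "(1/2) *\<^sub>R a + (1/2) *\<^sub>R b"
  have "?m \<in> D"
    using assms(1-3) by (intro convexD) auto
  then have "?r \<le> norm (z - ?m)"
    by (metis infdist_le dist_norm)
  then have mid: "?r\<^sup>2 \<le> (norm (z - ?m))\<^sup>2"
    by (rule power_mono) (rule infdist_nonneg)
  have a: "(norm (z - a))\<^sup>2 \<le> (?r + e)\<^sup>2" and b: "(norm (z - b))\<^sup>2 \<le> (?r + e)\<^sup>2"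
    using assms(4,5) by (auto intro!: power_mono simp: dist_norm)
  have "(dist a b)\<^sup>2 = 2 * (norm (z - a))\<^sup>2 + 2 * (norm (z - b))\<^sup>2 - 4 * (norm (z - ?m))\<^sup>2"
    unfolding dist_norm power2_norm_eq_inner
    by (simp add: inner_diff_left inner_diff_right inner_add_left inner_add_right inner_commute
        algebra_simps)
  also have "\<dots> \<le> 4 * (?r + e)\<^sup>2 - 4 * ?r\<^sup>2"
    using a b mid by linarith
  also have "\<dots> = 4 * e * (2 * ?r + e)"
    by (simp add: power2_eq_square algebra_simps)
  finally show ?thesis .
qed

text \<open>The sets of nearly closest points are closed, nested and of vanishing diameter, so
  completeness provides a common point.\<close>

lemma nearest_point_exists:
  fixes D :: "'a::{real_inner,complete_space} set"
  assumes "closed D" "convex D" "D \<noteq> {}"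
  obtains p where "p \<in> D" "\<And>x. x \<in> D \<Longrightarrow> dist z p \<le> dist z x"
proof -
  let ?r = "infdist z D"
  let ?e = "\<lambda>n. inverse (real (Suc n))"
  define S where "S n = D \<inter> cball z (?r + ?e n)" for n
  have "\<exists>p. \<forall>n. p \<in> S n"
  proof (rule decreasing_closed_nest)
    show "closed (S n)" for n
      unfolding S_def using assms(1) by (intro closed_Int closed_cball)
    show "S n \<noteq> {}" for n
    proof -
      have "\<exists>a\<in>D. dist z a < ?r + ?e n"
        by (subst cINF_less_iff[symmetric])
           (use assms(3) in \<open>auto simp: infdist_notempty[OF assms(3)]\<close>)
      then show ?thesis unfolding S_def by fastforce
    qed
    show "S n \<subseteq> S k" if "k \<le> n" for k n
    proof -
      have "?e n \<le> ?e k" using that by (intro le_imp_inverse_le) auto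
      then show ?thesis unfolding S_def by (intro Int_mono subset_cball add_left_mono order_refl)
    qed
    show "\<exists>n. \<forall>a\<in>S n. \<forall>b\<in>S n. dist a b < \<epsilon>" if "\<epsilon> > 0" for \<epsilon>
    proof -
      have "(\<lambda>n. 4 * ?e n * (2 * ?r + ?e n)) \<longlonglongrightarrow> 4 * 0 * (2 * ?r + 0)"
        by (intro tendsto_intros LIMSEQ_inverse_real_of_nat)
      then have "(\<lambda>n. 4 * ?e n * (2 * ?r + ?e n)) \<longlonglongrightarrow> 0" by simp
      then have "\<forall>\<^sub>F n in sequentially. 4 * ?e n * (2 * ?r + ?e n) < \<epsilon>\<^sup>2"
        by (rule order_tendstoD) (use that in simp)
      then obtain n where n: "4 * ?e n * (2 * ?r + ?e n) < \<epsilon>\<^sup>2"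
        by (auto simp: eventually_sequentially)
      have "dist a b < \<epsilon>" if "a \<in> S n" "b \<in> S n" for a b
      proof -
        have "(dist a b)\<^sup>2 \<le> 4 * ?e n * (2 * ?r + ?e n)"
          using that by (intro infdist_midpoint_bound assms(2)) (auto simp: S_def)
        then have "(dist a b)\<^sup>2 < \<epsilon>\<^sup>2" using n by linarith
        then show ?thesis using \<open>\<epsilon> > 0\<close> by (simp add: power2_less_imp_less)
      qed
      then show ?thesis by blast
    qed
  qed blast
  then obtain p where p: "\<And>n. p \<in> S n" by blast
  have "p \<in> D" using p[of 0] by (simp add: S_def)
  moreover have "dist z p \<le> dist z x" if "x \<in> D" for x
  proof -
    have "(\<lambda>n. ?r + ?e n) \<longlonglongrightarrow> ?r + 0"
      by (intro tendsto_intros LIMSEQ_inverse_real_of_nat)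
    then have "dist z p \<le> ?r + 0"
      by (rule LIMSEQ_le_const) (use p in \<open>auto simp: S_def\<close>)
    then show ?thesis using infdist_le[OF that, of z] by linarith
  qed
  ultimately show ?thesis using that by blast
qed

lemma proj_variational:
  fixes D :: "'a::{real_inner,complete_space} set"
  assumes "closed D" "convex D" "D \<noteq> {}"
  shows "proj D z \<in> D" and "x \<in> D \<Longrightarrow> inner (z - proj D z) (x - proj D z) \<le> 0"
proof -
  obtain p where p: "p \<in> D" "\<forall>x\<in>D. dist z p \<le> dist z x"
    using nearest_point_exists[OF assms] by metis
  have "proj D z = p"
    unfolding proj_def
    using p any_closest_point_unique[OF assms(2,1)] by (intro the_equality) blast+
  then show "proj D z \<in> D" and "x \<in> D \<Longrightarrow> inner (z - proj D z) (x - proj D z) \<le> 0"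
    using p any_closest_point_dot[OF assms(2,1)] by auto
qed

lemma support_function_normal:
  assumes "p \<in> D" "\<And>x. x \<in> D \<Longrightarrow> inner v (x - p) \<le> 0"
  shows "support_function v D = ereal (inner v p)"
  unfolding support_function_def
  using assms by (intro SUP_eqI) (auto simp: inner_diff_right)

lemma support_function_residual:
  assumes "closed D" "convex D" "D \<noteq> {}"
  shows "support_function (z - proj D z) D = ereal (inner (z - proj D z) (proj D z))"
  using proj_variational[OF assms] by (intro support_function_normal) auto

lemma support_function_ge: "p \<in> D \<Longrightarrow> ereal (inner v p) \<le> support_function v D"
  unfolding support_function_def by (rule SUP_upper)

section \<open>One sweep of the algorithm\<close>

text \<open>The lemmas of this section describe a single sweep through \<open>n\<close> blocks, with old multipliers
  \<open>w\<close>, new multipliers \<open>v\<close> and residuals \<open>u 0, \<dots>, u n\<close> between the updates. The equation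
  \<open>u i + v i = u (i-1) + w i\<close> says that an update preserves the sum of the residual and of all
  current multipliers.\<close>

lemma sweep_partial:
  fixes u v w :: "nat \<Rightarrow> 'a::real_inner"
  assumes "\<And>i. i \<in> {1..n} \<Longrightarrow> u i + v i = u (i-1) + w i" "l \<le> n"
  shows "u l - u n = (\<Sum>i=Suc l..n. v i - w i)"
proof -
  have "(\<Sum>i=Suc l..n. v i - w i) = (\<Sum>i=Suc l..n. - (u i - u (i - 1)))"
    using assms(1) by (intro sum.cong refl) (force simp: algebra_simps)
  also have "\<dots> = - (u n - u l)"
    unfolding sum_negf sum_telescope''[OF assms(2)] ..
  finally show ?thesis by simp
qed

text \<open>The gain of a proximal step. For a support function \<open>\<sigma>\<close>, the function
  \<open>t \<mapsto> \<parallel>u + w - t\<parallel>\<^sup>2 / 2 + \<sigma> t\<close> is strongly convex with modulus 1. The block update moves from \<open>w\<close> to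
  its minimizer \<open>v\<close>, where \<open>p\<close> is a subgradient of \<open>\<sigma>\<close> and \<open>\<sigma> v = inner v p\<close>; the number \<open>s\<close> stands
  for \<open>\<sigma> w\<close>.\<close>

lemma block_descent:
  fixes p u v w :: "'a::real_inner"
  assumes "p + v = u + w" "inner w p \<le> s"
  shows "1/2 * (norm p)\<^sup>2 + inner v p + 1/2 * (norm (v - w))\<^sup>2 \<le> 1/2 * (norm u)\<^sup>2 + s"
proof -
  have u: "u = p + (v - w)"
    using assms(1) by (simp add: algebra_simps)
  have "(norm u)\<^sup>2 = (norm p)\<^sup>2 + 2 * inner (v - w) p + (norm (v - w))\<^sup>2"
    unfolding u power2_norm_eq_inner
    by (simp add: inner_add_left inner_add_right inner_commute algebra_simps)
  moreover have "inner (v - w) p \<ge> inner v p - s"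
    using assms(2) by (simp add: inner_diff_left)
  ultimately show ?thesis by (simp add: field_simps)
qed

lemma sweep_descent:
  fixes u v w :: "nat \<Rightarrow> 'a::real_inner"
  assumes "\<And>i. i \<in> {1..n} \<Longrightarrow> u i + v i = u (i-1) + w i"
    and "\<And>i. i \<in> {1..n} \<Longrightarrow> inner (w i) (u i) \<le> s i"
  shows "1/2 * (norm (u n))\<^sup>2 + (\<Sum>i=1..n. inner (v i) (u i))
           + 1/2 * (\<Sum>i=1..n. (norm (v i - w i))\<^sup>2)
         \<le> 1/2 * (norm (u 0))\<^sup>2 + (\<Sum>i=1..n. s i)"
  using assms
proof (induction n)
  case 0
  then show ?case by simp
next
  case (Suc n)
  have IH: "1/2 * (norm (u n))\<^sup>2 + (\<Sum>i=1..n. inner (v i) (u i))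
           + 1/2 * (\<Sum>i=1..n. (norm (v i - w i))\<^sup>2)
         \<le> 1/2 * (norm (u 0))\<^sup>2 + (\<Sum>i=1..n. s i)"
    by (rule Suc.IH) (use Suc.prems in auto)
  have "1/2 * (norm (u (Suc n)))\<^sup>2 + inner (v (Suc n)) (u (Suc n))
          + 1/2 * (norm (v (Suc n) - w (Suc n)))\<^sup>2 \<le> 1/2 * (norm (u n))\<^sup>2 + s (Suc n)"
    using Suc.prems(1)[of "Suc n"] Suc.prems(2)[of "Suc n"] by (intro block_descent) auto
  with IH show ?case by (simp add: field_simps)
qed

text \<open>Convexity of the dual function, applied between the end of the sweep and an arbitrary
  comparison point \<open>a\<close>. In block \<open>i\<close>, the vector \<open>u i\<close> stands for a subgradient of the support function
  at \<open>v i\<close>, and \<open>- u n\<close> is the gradient of the quadratic term. Their sum \<open>u i - u n\<close> is the total of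
  the steps that follow the update of block \<open>i\<close>, so it is small when the sweep moves little.\<close>

lemma sweep_gap:
  fixes u v w a :: "nat \<Rightarrow> 'a::real_inner"
  assumes step: "\<And>i. i \<in> {1..n} \<Longrightarrow> u i + v i = u (i-1) + w i"
    and end_eq: "u n = d - (\<Sum>i=1..n. v i)"
    and supp: "\<And>i. i \<in> {1..n} \<Longrightarrow> inner (a i) (u i) \<le> s i"
    and bound: "\<And>i. i \<in> {1..n} \<Longrightarrow> norm (v i - a i) \<le> M i"
  shows "1/2 * (norm (u n))\<^sup>2 + (\<Sum>i=1..n. inner (v i) (u i))
           - (1/2 * (norm (d - (\<Sum>i=1..n. a i)))\<^sup>2 + (\<Sum>i=1..n. s i))
         \<le> (\<Sum>i=1..n. M i) * (\<Sum>i=1..n. norm (v i - w i))"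
proof -
  let ?q = "d - (\<Sum>i=1..n. a i)"
  let ?\<Delta> = "\<Sum>i=1..n. norm (v i - w i)"
  have diff: "?q - u n = (\<Sum>i=1..n. v i - a i)"
    unfolding end_eq by (simp add: sum_subtractf)
  have "(norm ?q)\<^sup>2 = (norm (u n))\<^sup>2 + 2 * inner (?q - u n) (u n) + (norm (?q - u n))\<^sup>2"
    unfolding power2_norm_eq_inner
    by (simp add: inner_diff_left inner_diff_right inner_commute algebra_simps)
  moreover have "(norm (?q - u n))\<^sup>2 \<ge> 0" by simp
  ultimately have quad: "1/2 * (norm (u n))\<^sup>2 - 1/2 * (norm ?q)\<^sup>2
      \<le> - (\<Sum>i=1..n. inner (v i - a i) (u n))"
    unfolding diff inner_sum_left by linarith
  have "(\<Sum>i=1..n. inner (v i) (u i)) - (\<Sum>i=1..n. s i)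
      \<le> (\<Sum>i=1..n. inner (v i - a i) (u i))"
    unfolding sum_subtractf[symmetric]
    using supp by (intro sum_mono) (simp add: inner_diff_left)
  with quad have "1/2 * (norm (u n))\<^sup>2 + (\<Sum>i=1..n. inner (v i) (u i))
           - (1/2 * (norm ?q)\<^sup>2 + (\<Sum>i=1..n. s i))
         \<le> (\<Sum>i=1..n. inner (v i - a i) (u i - u n))"
    by (simp add: inner_diff_right sum_subtractf)
  also have "\<dots> \<le> (\<Sum>i=1..n. M i * ?\<Delta>)"
  proof (rule sum_mono)
    fix i assume i: "i \<in> {1..n}"
    have "u i - u n = (\<Sum>j=Suc i..n. v j - w j)"
      using i by (intro sweep_partial step) auto
    then have "norm (u i - u n) \<le> (\<Sum>j=Suc i..n. norm (v j - w j))"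
      by (simp add: norm_sum)
    also have "\<dots> \<le> ?\<Delta>" by (intro sum_mono2) auto
    finally have tail: "norm (u i - u n) \<le> ?\<Delta>" .
    have "inner (v i - a i) (u i - u n) \<le> norm (v i - a i) * norm (u i - u n)"
      by (rule norm_cauchy_schwarz)
    also have "\<dots> \<le> M i * ?\<Delta>"
      using bound[OF i] tail order_trans[OF norm_ge_zero bound[OF i]] by (intro mult_mono) auto
    finally show "inner (v i - a i) (u i - u n) \<le> M i * ?\<Delta>" .
  qed
  finally show ?thesis by (simp add: sum_distrib_right)
qed

section \<open>Rate of a quadratic recursion\<close>

text \<open>If \<open>e n \<le> K / n\<close> but \<open>e (n+1) > K / (n+1)\<close>, the decrease from \<open>e n\<close> to \<open>e (n+1)\<close> is less than
  \<open>K / (n (n+1))\<close>, while the recursion forces it to exceed \<open>(K / (n+1))\<^sup>2 / A\<close>. As \<open>(n+1) / n \<le> 2\<close>, this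
  is impossible for \<open>K \<ge> 2 A\<close>; taking \<open>K \<ge> e 1\<close> as well starts the induction.\<close>

lemma quadratic_recursion_rate:
  fixes e :: "nat \<Rightarrow> real"
  assumes "A > 0" "\<And>k. k \<ge> 1 \<Longrightarrow> e k \<ge> 0"
    and rec: "\<And>k. k \<ge> 2 \<Longrightarrow> (e k)\<^sup>2 \<le> A * (e (k-1) - e k)"
    and "k \<ge> 1"
  shows "e k \<le> max (e 1) (2 * A) / real k"
  using \<open>k \<ge> 1\<close>
proof (induction k rule: dec_induct)
  case base
  then show ?case by simp
next
  case (step n)
  let ?K = "max (e 1) (2 * A)"
  have "?K > 0" "?K \<ge> 2 * A" using \<open>A > 0\<close> by auto
  show ?case
  proof (rule ccontr)
    assume "\<not> ?thesis"
    then have gt: "e (Suc n) > ?K / (real n + 1)" by (simp add: add.commute)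
    have "?K / (real n + 1) > 0" using \<open>?K > 0\<close> by (intro divide_pos_pos) auto
    then have "(?K / (real n + 1))\<^sup>2 < (e (Suc n))\<^sup>2"
      using gt by (intro power_strict_mono) auto
    also have "\<dots> \<le> A * (e n - e (Suc n))"
      using rec[of "Suc n"] step.hyps by simp
    also have "\<dots> \<le> A * (?K / real n - ?K / (real n + 1))"
      using step.IH gt \<open>A > 0\<close> by (intro mult_left_mono) auto
    also have "\<dots> = A * ?K / (real n * (real n + 1))"
      using step.hyps by (simp add: field_simps)
    finally have "?K * ?K / ((real n + 1) * (real n + 1)) < A * ?K / (real n * (real n + 1))"
      by (simp add: power2_eq_square)
    then have "?K * real n < A * (real n + 1)"
      using \<open>?K > 0\<close> step.hyps by (simp add: divide_simps mult_ac split: if_splits)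
    moreover have "2 * A * real n \<le> ?K * real n"
      by (intro mult_right_mono) auto
    moreover have "A * (real n + 1) \<le> A * (2 * real n)"
      using step.hyps \<open>A > 0\<close> by (intro mult_left_mono) auto
    ultimately show False by (simp add: mult_ac)
  qed
qed


section \<open>Optimality at a dual minimizer\<close>

lemma dual_h_eq_real:
  assumes "\<And>i. i \<in> {1..m} \<Longrightarrow> support_function (v i) (C i) = ereal (s i)"
  shows "dual_h d m C v = ereal (1/2 * (norm (d - (\<Sum>i=1..m. v i)))\<^sup>2 + (\<Sum>i=1..m. s i))"
proof -
  have "(\<Sum>i=1..m. support_function (v i) (C i)) = (\<Sum>i=1..m. ereal (s i))"
    using assms by (intro sum.cong) auto
  then show ?thesis by (simp add: dual_h_def)
qed

text \<open>A minimizer of the dual function is a fixed point of every block update: replacing \<open>a i\<close> by the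
  projection residual \<open>b\<close> lowers the value by at least \<open>\<parallel>b - a i\<parallel>\<^sup>2 / 2\<close>, so \<open>b = a i\<close>, and then \<open>q\<close>
  is the projection itself. In particular \<open>q\<close> is primal feasible.\<close>

lemma dual_minimizer_optimality:
  fixes d :: "'a::{real_inner,complete_space}"
  assumes C: "\<forall>i\<in>{1..m}. closed (C i)" "\<forall>i\<in>{1..m}. convex (C i)"
      "\<forall>i\<in>{1..m}. C i \<noteq> {}"
    and min: "\<And>v. dual_h d m C a \<le> dual_h d m C v"
    and i: "i \<in> {1..m}"
  defines "q \<equiv> d - (\<Sum>i=1..m. a i)"
  shows "q \<in> C i" and "support_function (a i) (C i) = ereal (inner (a i) q)"
proof -
  (* The zero multiplier has a finite value, so the minimal value is finite too. *)
  have "dual_h d m C (\<lambda>_. 0) = ereal (1/2 * (norm (d - (\<Sum>i=1..m. 0)))\<^sup>2 + (\<Sum>i=1..m. 0))"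
    using C(3) by (intro dual_h_eq_real) (auto simp: support_function_def zero_ereal_def)
  then have "dual_h d m C a \<noteq> \<infinity>"
    using min[of "\<lambda>_. 0"] by auto
  then have "(\<Sum>j=1..m. support_function (a j) (C j)) \<noteq> \<infinity>"
    unfolding dual_h_def by auto
  then have fin: "support_function (a j) (C j) \<noteq> \<infinity>" if "j \<in> {1..m}" for j
    using that unfolding sum_Pinfty by blast
  define s where "s j = real_of_ereal (support_function (a j) (C j))" for j
  have s: "support_function (a j) (C j) = ereal (s j)" if j: "j \<in> {1..m}" for j
  proof -
    obtain c where "c \<in> C j" using C(3) j by blast
    then have "support_function (a j) (C j) \<noteq> -\<infinity>"
      using support_function_ge[of c "C j" "a j"] by auto
    then show ?thesis using fin[OF j] unfolding s_def by (cases "support_function (a j) (C j)") auto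
  qed
  define z p b where "z = q + a i" and "p = proj (C i) z" and "b = z - p"
  have p: "p \<in> C i"
    unfolding p_def by (rule proj_variational(1)[OF C(1-3)[rule_format, OF i]])
  have supp_b: "support_function b (C i) = ereal (inner b p)"
    unfolding b_def p_def by (rule support_function_residual[OF C(1-3)[rule_format, OF i]])
  have sum_update: "(\<Sum>j=1..m. (f(i := c)) j) = (\<Sum>j=1..m. f j) - f i + c"
    for f :: "nat \<Rightarrow> 'b::ab_group_add" and c
  proof -
    have "(\<Sum>j\<in>{1..m} - {i}. (f(i := c)) j) = (\<Sum>j\<in>{1..m} - {i}. f j)"
      by (rule sum.cong) auto
    then show ?thesis
      unfolding sum.remove[OF finite_atLeastAtMost i] by simp
  qed
  have "dual_h d m C (a(i := b)) =
      ereal (1/2 * (norm (d - (\<Sum>j=1..m. (a(i := b)) j)))\<^sup>2 + (\<Sum>j=1..m. (s(i := inner b p)) j))"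
    using supp_b s by (intro dual_h_eq_real) auto
  also have "(\<Sum>j=1..m. (a(i := b)) j) = d - p"
    unfolding sum_update by (simp add: b_def z_def q_def)
  also have "(\<Sum>j=1..m. (s(i := inner b p)) j) = (\<Sum>j=1..m. s j) - s i + inner b p"
    by (rule sum_update)
  finally have "1/2 * (norm q)\<^sup>2 + s i \<le> 1/2 * (norm p)\<^sup>2 + inner b p"
    using min[of "a(i := b)"] dual_h_eq_real[of m a C s d, OF s] by (simp add: q_def del: fun_upd_apply)
  moreover have "1/2 * (norm p)\<^sup>2 + inner b p + 1/2 * (norm (b - a i))\<^sup>2 \<le> 1/2 * (norm q)\<^sup>2 + s i"
    using support_function_ge[OF p, of "a i"] s[OF i]
    by (intro block_descent) (auto simp: b_def z_def)
  ultimately have "(norm (b - a i))\<^sup>2 \<le> 0" by linarith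
  then have "b = a i" by simp
  then have "q = p" by (simp add: b_def z_def)
  with p supp_b \<open>b = a i\<close> show "q \<in> C i"
    and "support_function (a i) (C i) = ereal (inner (a i) q)" by simp_all
qed

section \<open>Extended Dykstra's algorithm\<close>

text \<open>The last two facts concern the halfspace \<open>H k\<close>: it supports \<open>D k\<close> at the projection
  \<open>x k (m+1)\<close>, so it has the same support value as \<open>D k\<close> at \<open>y k (m+1)\<close> and still contains the
  intersection of all \<open>C i\<close>.\<close>

lemma extended_dykstra_iterates:
  fixes d :: "'a::{real_inner,complete_space}"
  assumes C: "\<forall>i\<in>{1..m}. closed (C i)" "\<forall>i\<in>{1..m}. convex (C i)"
      "(\<Inter>i\<in>{1..m}. C i) \<noteq> {}"
    and alg: "extended_dykstra d m C D H x y z" and k: "k \<ge> 1"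
  shows "x k 0 = x (k-1) (m+1)"
    and "i \<in> {1..m+1} \<Longrightarrow> x k i + y k i = x k (i-1) + y (k-1) i"
    and "i \<in> {1..m} \<Longrightarrow> x k i \<in> C i"
    and "i \<in> {1..m} \<Longrightarrow> support_function (y k i) (C i) = ereal (inner (y k i) (x k i))"
    and "x k (m+1) \<in> H (k-1)"
    and "support_function (y k (m+1)) (H k) = ereal (inner (y k (m+1)) (x k (m+1)))"
    and "(\<Inter>i\<in>{1..m}. C i) \<subseteq> H k"
proof -
  note a = alg[unfolded extended_dykstra_def, THEN conjunct2, THEN conjunct2, THEN conjunct2,
      rule_format, OF k]
  show "x k 0 = x (k-1) (m+1)" using a by blast
  have blk: "z k i = x k (i-1) + y (k-1) i" "x k i = proj (C i) (z k i)" "y k i = z k i - x k i"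
    if "i \<in> {1..m}" for i using a that by blast+
  have last: "z k (m+1) = x k m + y (k-1) (m+1)" "x k (m+1) = proj (D k) (z k (m+1))"
      "y k (m+1) = z k (m+1) - x k (m+1)" and D: "closed (D k)" "convex (D k)"
      "(\<Inter>i\<in>{1..m}. C i) \<subseteq> D k" "D k \<subseteq> H (k-1)"
      and H: "H k = {u. inner (y k (m+1)) (u - x k (m+1)) \<le> 0}"
    using a by blast+
  have D_ne: "D k \<noteq> {}" using C(3) D(3) by blast
  show "x k i + y k i = x k (i-1) + y (k-1) i" if "i \<in> {1..m+1}"
  proof (cases "i = m+1")
    case True
    with last(1,3) show ?thesis by simp
  next
    case False
    with that have "i \<in> {1..m}" by auto
    from blk(1,3)[OF this] show ?thesis by simp
  qed
  show "x k i \<in> C i" if i: "i \<in> {1..m}"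
    unfolding blk(2)[OF i] using C i by (intro proj_variational(1)) auto
  show "support_function (y k i) (C i) = ereal (inner (y k i) (x k i))" if i: "i \<in> {1..m}"
    unfolding blk(3)[OF i] blk(2)[OF i] using C i by (intro support_function_residual) auto
  show "x k (m+1) \<in> H (k-1)"
    using proj_variational(1)[OF D(1,2) D_ne, of "z k (m+1)"] D(4) last(2) by auto
  show "support_function (y k (m+1)) (H k) = ereal (inner (y k (m+1)) (x k (m+1)))"
    unfolding H by (intro support_function_normal) auto
  have "D k \<subseteq> H k"
    unfolding H last(3) using proj_variational(2)[OF D(1,2) D_ne, of _ "z k (m+1)"] last(2) by auto
  then show "(\<Inter>i\<in>{1..m}. C i) \<subseteq> H k" using D(3) by blast
qed

lemma extended_dykstra_residual:
  fixes d :: "'a::{real_inner,complete_space}"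
  assumes C: "\<forall>i\<in>{1..m}. closed (C i)" "\<forall>i\<in>{1..m}. convex (C i)"
      "(\<Inter>i\<in>{1..m}. C i) \<noteq> {}"
    and alg: "extended_dykstra d m C D H x y z"
  shows "x k (m+1) = d - (\<Sum>i=1..m+1. y k i)"
proof (induction k)
  case 0
  show ?case using alg unfolding extended_dykstra_def by blast
next
  case (Suc k)
  note it = extended_dykstra_iterates[OF C alg, of "Suc k"]
  have "x (Suc k) 0 - x (Suc k) (m+1) = (\<Sum>i=Suc 0..m+1. y (Suc k) i - y k i)"
    using it(2) by (intro sweep_partial) auto
  also have "\<dots> = (\<Sum>i=1..m+1. y (Suc k) i) - (\<Sum>i=1..m+1. y k i)"
    by (simp only: sum_subtractf One_nat_def)
  finally show ?case
    using it(1) Suc.IH by (simp add: algebra_simps)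
qed

theorem theorem4p5:
  fixes d :: "'a::{real_inner,complete_space}"
    and m :: nat
    and C D H :: "nat \<Rightarrow> 'a set"
    and x y z :: "nat \<Rightarrow> nat \<Rightarrow> 'a"
    and ystar :: "nat \<Rightarrow> 'a"
  assumes "m \<ge> 1"
    and "\<And>i. i \<in> {1..m} \<Longrightarrow> closed (C i)"
    and "\<And>i. i \<in> {1..m} \<Longrightarrow> convex (C i)"
    and "(\<Inter>i\<in>{1..m}. C i) \<noteq> {}"
    and "extended_dykstra d m C D H x y z"
    and "\<And>v. dual_h d m C ystar \<le> dual_h d m C v"
    and "ystar (m+1) = 0"
    and "\<And>i. i \<in> {1..m+1} \<Longrightarrow> (SUP k. ereal (norm (y k i - ystar i))) < \<infinity>"
  shows "\<exists>K::real. \<forall>k\<ge>1.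
           \<bar>dual_hk d m C (H k) (y k) - dual_h d m C ystar\<bar> \<le> ereal (K / real k)"
proof -
  define n where "n = m + 1"
  have C: "\<forall>i\<in>{1..m}. closed (C i)" "\<forall>i\<in>{1..m}. convex (C i)" "\<forall>i\<in>{1..m}. C i \<noteq> {}"
    using assms(2-4) by blast+
  note it = extended_dykstra_iterates[OF C(1,2) assms(4,5), folded n_def]
  note residual = extended_dykstra_residual[OF C(1,2) assms(4,5), folded n_def]
  have blocks: "i \<in> {1..m} \<or> i = n" if "i \<in> {1..n}" for i
    using that by (auto simp: n_def)
  have sum_n: "(\<Sum>i=1..n. g i) = (\<Sum>i=1..m. g i) + g n" for g :: "nat \<Rightarrow> 'b::comm_monoid_add"
    by (simp add: n_def)

  define q where "q = d - (\<Sum>i=1..m. ystar i)"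
  note q = dual_minimizer_optimality[OF C assms(6), folded q_def]
  have star_n: "ystar n = 0" using assms(7) by (simp add: n_def)
  have q_n: "q = d - (\<Sum>i=1..n. ystar i)"
    by (simp only: q_def sum_n star_n add_0_right)

  define h_min where "h_min = 1/2 * (norm q)\<^sup>2 + (\<Sum>i=1..n. inner (ystar i) q)"
  define E where "E k = 1/2 * (norm (x k n))\<^sup>2 + (\<Sum>i=1..n. inner (y k i) (x k i))" for k
  define e where "e k = E k - h_min" for k
  define \<Delta> where "\<Delta> k i = y k i - y (k-1) i" for k i
  have h_min: "dual_h d m C ystar = ereal h_min"
    using dual_h_eq_real[of m ystar C "\<lambda>i. inner (ystar i) q" d, OF q(2)]
    unfolding h_min_def sum_n star_n by (simp add: q_def)
  have hk: "dual_hk d m C (H k) (y k) = ereal (E k)" if "k \<ge> 1" for k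
  proof -
    have "(\<Sum>i=1..m. support_function (y k i) (C i)) = (\<Sum>i=1..m. ereal (inner (y k i) (x k i)))"
      using it(4)[OF that] by (intro sum.cong) auto
    then show ?thesis
      unfolding dual_hk_def n_def[symmetric] residual[symmetric] it(6)[OF that] E_def
      by (simp add: sum_n del: One_nat_def)
  qed

  (* Weak duality with the primal point q, which belongs to all sets that occur. *)
  have nonneg: "e k \<ge> 0" if k: "k \<ge> 1" for k
  proof -
    have "inner (y k i) q \<le> inner (y k i) (x k i)" if "i \<in> {1..n}" for i
      using blocks[OF that]
    proof
      assume i: "i \<in> {1..m}"
      show ?thesis
        using support_function_ge[OF q(1)[OF i], of "y k i"] it(4)[OF k i] by simp
    next
      assume "i = n"
      have "q \<in> H k" using it(7)[OF k] q(1) by blast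
      then show ?thesis
        using support_function_ge[of q "H k" "y k n"] it(6)[OF k] \<open>i = n\<close> by simp
    qed
    then have "(\<Sum>i=1..n. inner (y k i) q) \<le> (\<Sum>i=1..n. inner (y k i) (x k i))"
      by (rule sum_mono)
    moreover have "(\<Sum>i=1..n. inner (y k i) q) = inner (d - x k n) q"
      "(\<Sum>i=1..n. inner (ystar i) q) = inner (d - q) q"
      by (simp_all add: residual[of k] q_n inner_sum_left[symmetric])
    moreover have "1/2 * (norm (x k n))\<^sup>2 + inner (d - x k n) q
        - (1/2 * (norm q)\<^sup>2 + inner (d - q) q) = 1/2 * (norm (x k n - q))\<^sup>2"
      unfolding power2_norm_eq_inner
      by (simp add: inner_diff_left inner_diff_right inner_commute field_simps)
    moreover have "1/2 * (norm (x k n - q))\<^sup>2 \<ge> 0" by simp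
    ultimately show ?thesis unfolding e_def E_def h_min_def by linarith
  qed

  (* For k = 1 the value at the previous iterate may be infinite, hence k \<ge> 2. *)
  have descent: "(\<Sum>i=1..n. (norm (\<Delta> k i))\<^sup>2) \<le> 2 * (e (k-1) - e k)" if k: "k \<ge> 2" for k
  proof -
    have k1: "k \<ge> 1" "k - 1 \<ge> 1" using k by auto
    have old: "inner (y (k-1) i) (x k i) \<le> inner (y (k-1) i) (x (k-1) i)" if "i \<in> {1..n}" for i
      using blocks[OF that]
    proof
      assume i: "i \<in> {1..m}"
      show ?thesis
        using support_function_ge[OF it(3)[OF k1(1) i], of "y (k-1) i"] it(4)[OF k1(2) i] by simp
    next
      assume "i = n"
      then show ?thesis
        using support_function_ge[OF it(5)[OF k1(1)], of "y (k-1) n"] it(6)[OF k1(2)] by simp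
    qed
    have "1/2 * (norm (x k n))\<^sup>2 + (\<Sum>i=1..n. inner (y k i) (x k i))
           + 1/2 * (\<Sum>i=1..n. (norm (y k i - y (k-1) i))\<^sup>2)
         \<le> 1/2 * (norm (x k 0))\<^sup>2 + (\<Sum>i=1..n. inner (y (k-1) i) (x (k-1) i))"
      by (rule sweep_descent[where u = "x k" and w = "y (k-1)", OF it(2)[OF k1(1)] old])
    then show ?thesis
      unfolding e_def E_def \<Delta>_def it(1)[OF k1(1)] by (simp add: algebra_simps)
  qed

  define M where "M i = real_of_ereal (SUP k. ereal (norm (y k i - ystar i)))" for i
  have M: "norm (y k i - ystar i) \<le> M i" if "i \<in> {1..n}" for k i
  proof -
    let ?S = "SUP k. ereal (norm (y k i - ystar i))"
    have le: "ereal (norm (y k i - ystar i)) \<le> ?S" by (rule SUP_upper) simp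
    moreover have "?S < \<infinity>" using assms(8) that by (simp add: n_def)
    ultimately have "?S = ereal (M i)" unfolding M_def by (cases ?S) auto
    with le show ?thesis by simp
  qed
  define B where "B = (\<Sum>i=1..n. M i)"
  have gap: "e k \<le> B * (\<Sum>i=1..n. norm (\<Delta> k i))" if k: "k \<ge> 1" for k
  proof -
    have supp: "inner (ystar i) (x k i) \<le> inner (ystar i) q" if "i \<in> {1..n}" for i
      using blocks[OF that]
    proof
      assume i: "i \<in> {1..m}"
      show ?thesis
        using support_function_ge[OF it(3)[OF k i], of "ystar i"] q(2)[OF i] by simp
    qed (simp add: star_n)
    show ?thesis
      using sweep_gap[where u = "x k" and v = "y k", OF it(2)[OF k] residual supp M]
      unfolding e_def E_def h_min_def B_def \<Delta>_def q_n by simp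
  qed

  (* The summand 1 keeps A positive when all iterates coincide with the minimizer. *)
  define A where "A = 2 * B\<^sup>2 * real n + 1"
  have "A > 0" unfolding A_def by (simp add: add_nonneg_pos)
  have recursion: "(e k)\<^sup>2 \<le> A * (e (k-1) - e k)" if k: "k \<ge> 2" for k
  proof -
    let ?S = "\<Sum>i=1..n. (norm (\<Delta> k i))\<^sup>2"
    have "(e k)\<^sup>2 \<le> (B * (\<Sum>i=1..n. norm (\<Delta> k i)))\<^sup>2"
      using k by (intro power_mono gap nonneg) auto
    also have "\<dots> = B\<^sup>2 * (\<Sum>i=1..n. norm (\<Delta> k i))\<^sup>2" by (rule power_mult_distrib)
    also have "\<dots> \<le> B\<^sup>2 * (?S * real n)"
      using sum_squared_le_sum_of_squares[of "\<lambda>i. norm (\<Delta> k i)" "{1..n}"]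
      by (intro mult_left_mono) auto
    also have "\<dots> \<le> B\<^sup>2 * (2 * (e (k-1) - e k) * real n)"
      by (intro mult_left_mono mult_right_mono descent k) auto
    also have "\<dots> = (2 * B\<^sup>2 * real n) * (e (k-1) - e k)" by simp
    also have "\<dots> \<le> A * (e (k-1) - e k)"
    proof (rule mult_right_mono)
      have "0 \<le> ?S" by (intro sum_nonneg) simp
      then have "0 \<le> 2 * (e (k-1) - e k)" using descent[OF k] by (rule order_trans)
      then show "0 \<le> e (k-1) - e k" by simp
    qed (simp add: A_def)
    finally show ?thesis .
  qed

  have "\<bar>dual_hk d m C (H k) (y k) - dual_h d m C ystar\<bar>
      \<le> ereal (max (e 1) (2 * A) / real k)" if k: "k \<ge> 1" for k
    using quadratic_recursion_rate[of A e, OF \<open>A > 0\<close> nonneg recursion k] nonneg[OF k]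
    unfolding hk[OF k] h_min by (simp add: e_def)
  then show ?thesis by blast
qed

end
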